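(* Let $a\in\mathbb{R}$, let $f,g$ be smooth real functions of $y$, and consider the Type-I, Type-II and Type-III twisted surfaces in $E_1^3$ with $b=0$. Let $p,q,r\in\{1,-1\}$ be the signs of the causal types of the surface, the loxodrome and the meridians respectively ($1$ for spacelike, $-1$ for timelike). The differential equations of the loxodromes which cut all meridians ($y=\text{constant}$) at a constant angle $\theta$ on - the Type-I twisted surface (except the cases $p=-q=r=-1$ and $p=q=r=-1$), - the Type-II twisted surface (except the cases $p=-q=r=-1$ and $p=q=r=-1$), - the Type-III twisted surface (except the cases $p=q=r=1$, $-p=q=r=1$ and $-p=-q=r=1$) are $$\frac{\sqrt{p(rf'^{2}-g'^{2})}}{C}\,dy=\pm\frac{A}{\sqrt{qr-pA^{2}}}\,dx$$ (for one of the two choices of the sign $\pm$ at each point), where $f'=df/dy$, $g'=dg/dy$, $$A=\begin{cases}\sin\theta & \text{if } p=1,\\ \sinh\theta & \text{if } p=-1\text{ and } qr=1,\\ \cosh\theta & \text{if } p=-1\text{ and } qr=-1,\end{cases}$$ and $C=a+f$ for Type-I and Type-III twisted surfaces, $C=a+g$ for Type-II twisted surfaces.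
   Context: $E_1^3$ is $\mathbb{R}^3$ with the metric $\langle u,v\rangle=u_1v_1+u_2v_2-u_3v_3$, and $\|u\|=\sqrt{|\langle u,u\rangle|}$. With real constants $a,b$ and functions $f=f(y)$, $g=g(y)$, the twisted surfaces are: - Type-I: $\Omega(x,y)=(a+f\cosh(bx)+g\sinh(bx))(\cos x,\sin x,0)+(0,0,f\sinh(bx)+g\cosh(bx))$; for $b=0$: $((a+f)\cos x,(a+f)\sin x,g)$. - Type-II: $\Omega(x,y)=(a+f\sinh(bx)+g\cosh(bx))(0,\sinh x,\cosh x)+(f\cosh(bx)+g\sinh(bx),0,0)$; for $b=0$: $(f,(a+g)\sinh x,(a+g)\cosh x)$. - Type-III: $\Omega(x,y)=(a+f\cos(bx)-g\sin(bx))(\cosh x,0,\sinh x)+(0,f\sin(bx)+g\cos(bx),0)$; for $b=0$: $((a+f)\cosh x,g,(a+f)\sinh x)$. A vector $u$ is spacelike if $\langle u,u\rangle>0$ or $u=0$, timelike if $\langle u,u\rangle<0$, lightlike if $\langle u,u\rangle=0$ (and $u\neq0$). A curve is spacelike (timelike) if all its tangent vectors are. A surface $\Omega(x,y)$ with $g_{11}=\langle\Omega_x,\Omega_x\rangle$, $g_{12}=\langle\Omega_x,\Omega_y\rangle$, $g_{22}=\langle\Omega_y,\Omega_y\rangle$ is spacelike (timelike) if all its tangent planes are spacelike (timelike), i.e. $g_{11}g_{22}-g_{12}^2>0$ (respectively $<0$). On a spacelike surface necessarily $q=r=1$. The surface, the loxodrome and the meridians are each assumed spacelike or timelike. Meridians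 are the curves $y=\text{constant}$, with tangent $\Omega_x$. A loxodrome is a curve $t\mapsto\Omega(x(t),y(t))$ on the surface that cuts all meridians at a constant angle $\theta$. Here $dx/dt\neq0$, and with $T=\frac{dx}{dt}\Omega_x+\frac{dy}{dt}\Omega_y$ the constant angle $\theta$ condition means: - surface, loxodrome, meridian all spacelike ($p=q=r=1$): $\theta\in[0,\pi]$ and $\langle\Omega_x,T\rangle=\|\Omega_x\|\|T\|\cos\theta$; - timelike surface, loxodrome and meridian spacelike ($p=-1$, $q=r=1$): $\theta>0$ and $\langle\Omega_x,T\rangle=\varepsilon\|\Omega_x\|\|T\|\cosh\theta$ with $\varepsilon=\pm1$; - timelike surface, one of loxodrome and meridian spacelike and the other timelike ($p=-1$, $qr=-1$): $\theta\ge0$ and $\langle\Omega_x,T\rangle=\varepsilon\|\Omega_x\|\|T\|\sinh\theta$ with $\varepsilon=\pm1$; - timelike surface, loxodrome and meridian timelike ($p=q=r=-1$): $\theta>0$ and $\langle\Omega_x,T\rangle=-\|\Omega_x\|\|T\|\cosh\theta$. *)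

theory Defs
  imports "HOL-Analysis.Analysis"
begin

definition lorentz :: "real^3 \<Rightarrow> real^3 \<Rightarrow> real" where
  "lorentz u v = u $ 1 * v $ 1 + u $ 2 * v $ 2 - u $ 3 * v $ 3"

definition lorentz_norm :: "real^3 \<Rightarrow> real" where
  "lorentz_norm u = sqrt \<bar>lorentz u u\<bar>"

definition spacelike :: "real^3 \<Rightarrow> bool" where
  "spacelike u \<longleftrightarrow> lorentz u u > 0 \<or> u = 0"

definition timelike :: "real^3 \<Rightarrow> bool" where
  "timelike u \<longleftrightarrow> lorentz u u < 0"

definition spacelike_curve :: "(real \<Rightarrow> real^3) \<Rightarrow> real set \<Rightarrow> bool" where
  "spacelike_curve c I \<longleftrightarrow> (\<forall>t\<in>I. spacelike (vector_derivative c (at t)))"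

definition timelike_curve :: "(real \<Rightarrow> real^3) \<Rightarrow> real set \<Rightarrow> bool" where
  "timelike_curve c I \<longleftrightarrow> (\<forall>t\<in>I. timelike (vector_derivative c (at t)))"

definition curve_sign :: "real \<Rightarrow> (real \<Rightarrow> real^3) \<Rightarrow> real set \<Rightarrow> bool" where
  "curve_sign s c I \<longleftrightarrow> s = 1 \<and> spacelike_curve c I \<or> s = -1 \<and> timelike_curve c I"

definition partial_x :: "(real \<Rightarrow> real \<Rightarrow> real^3) \<Rightarrow> real \<Rightarrow> real \<Rightarrow> real^3" where
  "partial_x S x y = vector_derivative (\<lambda>s. S s y) (at x)"

definition partial_y :: "(real \<Rightarrow> real \<Rightarrow> real^3) \<Rightarrow> real \<Rightarrow> real \<Rightarrow> real^3" where
  "partial_y S x y = vector_derivative (\<lambda>s. S x s) (at y)"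

definition gram_det :: "(real \<Rightarrow> real \<Rightarrow> real^3) \<Rightarrow> real \<Rightarrow> real \<Rightarrow> real" where
  "gram_det S x y =
     lorentz (partial_x S x y) (partial_x S x y) * lorentz (partial_y S x y) (partial_y S x y)
     - (lorentz (partial_x S x y) (partial_y S x y))\<^sup>2"

(* All surfaces below are parametrised over UNIV \<times> J: the parameter x ranges over all reals,
   only the domain J of the profile functions f and g may be restricted. *)

definition spacelike_surface :: "(real \<Rightarrow> real \<Rightarrow> real^3) \<Rightarrow> real set \<Rightarrow> bool" where
  "spacelike_surface S J \<longleftrightarrow> (\<forall>x. \<forall>y\<in>J. gram_det S x y > 0)"

definition timelike_surface :: "(real \<Rightarrow> real \<Rightarrow> real^3) \<Rightarrow> real set \<Rightarrow> bool" where
  "timelike_surface S J \<longleftrightarrow> (\<forall>x. \<forall>y\<in>J. gram_det S x y < 0)"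

definition surface_sign :: "real \<Rightarrow> (real \<Rightarrow> real \<Rightarrow> real^3) \<Rightarrow> real set \<Rightarrow> bool" where
  "surface_sign s S J \<longleftrightarrow> s = 1 \<and> spacelike_surface S J \<or> s = -1 \<and> timelike_surface S J"

definition meridian_sign :: "real \<Rightarrow> (real \<Rightarrow> real \<Rightarrow> real^3) \<Rightarrow> real set \<Rightarrow> bool" where
  "meridian_sign s S J \<longleftrightarrow> (\<forall>y\<in>J. curve_sign s (\<lambda>x. S x y) UNIV)"

definition twisted_I ::
  "real \<Rightarrow> real \<Rightarrow> (real \<Rightarrow> real) \<Rightarrow> (real \<Rightarrow> real) \<Rightarrow> real \<Rightarrow> real \<Rightarrow> real^3" where
  "twisted_I a b f g x y =
     (a + f y * cosh (b * x) + g y * sinh (b * x)) *\<^sub>R vector [cos x, sin x, 0]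
     + vector [0, 0, f y * sinh (b * x) + g y * cosh (b * x)]"

definition twisted_II ::
  "real \<Rightarrow> real \<Rightarrow> (real \<Rightarrow> real) \<Rightarrow> (real \<Rightarrow> real) \<Rightarrow> real \<Rightarrow> real \<Rightarrow> real^3" where
  "twisted_II a b f g x y =
     (a + f y * sinh (b * x) + g y * cosh (b * x)) *\<^sub>R vector [0, sinh x, cosh x]
     + vector [f y * cosh (b * x) + g y * sinh (b * x), 0, 0]"

definition twisted_III ::
  "real \<Rightarrow> real \<Rightarrow> (real \<Rightarrow> real) \<Rightarrow> (real \<Rightarrow> real) \<Rightarrow> real \<Rightarrow> real \<Rightarrow> real^3" where
  "twisted_III a b f g x y =
     (a + f y * cos (b * x) - g y * sin (b * x)) *\<^sub>R vector [cosh x, 0, sinh x]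
     + vector [0, f y * sin (b * x) + g y * cos (b * x), 0]"

(* For open J this is C-infinity on J. *)
definition smooth_fun_on :: "real set \<Rightarrow> (real \<Rightarrow> real) \<Rightarrow> bool" where
  "smooth_fun_on J f \<longleftrightarrow> (\<forall>n. \<forall>y\<in>J. (deriv ^^ n) f differentiable (at y))"

(* The curve t \<mapsto> S (x t) (y t), t in K, has causal sign q and is nowhere tangent to the
   curves x = constant. *)
definition admissible_curve ::
  "(real \<Rightarrow> real \<Rightarrow> real^3) \<Rightarrow> real set \<Rightarrow> real \<Rightarrow> (real \<Rightarrow> real) \<Rightarrow> (real \<Rightarrow> real) \<Rightarrow> real set \<Rightarrow> bool"
where
  "admissible_curve S J q x y K \<longleftrightarrow>
     K \<noteq> {} \<and> open K \<and> is_interval K \<and>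
     (\<forall>t\<in>K. y t \<in> J \<and> x differentiable (at t) \<and> y differentiable (at t) \<and> deriv x t \<noteq> 0) \<and>
     curve_sign q (\<lambda>t. S (x t) (y t)) K"

definition tangent ::
  "(real \<Rightarrow> real \<Rightarrow> real^3) \<Rightarrow> (real \<Rightarrow> real) \<Rightarrow> (real \<Rightarrow> real) \<Rightarrow> real \<Rightarrow> real^3" where
  "tangent S x y t = deriv x t *\<^sub>R partial_x S (x t) (y t) + deriv y t *\<^sub>R partial_y S (x t) (y t)"

definition angle_range :: "real \<Rightarrow> real \<Rightarrow> real \<Rightarrow> real \<Rightarrow> bool" where
  "angle_range p q r \<theta> \<longleftrightarrow>
     p = 1 \<and> q = 1 \<and> r = 1 \<and> 0 \<le> \<theta> \<and> \<theta> \<le> pi \<or>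
     p = -1 \<and> q = 1 \<and> r = 1 \<and> 0 < \<theta> \<or>
     p = -1 \<and> q * r = -1 \<and> 0 \<le> \<theta> \<or>
     p = -1 \<and> q = -1 \<and> r = -1 \<and> 0 < \<theta>"

definition cuts_at_angle ::
  "(real \<Rightarrow> real \<Rightarrow> real^3) \<Rightarrow> real \<Rightarrow> real \<Rightarrow> real \<Rightarrow> real \<Rightarrow>
   (real \<Rightarrow> real) \<Rightarrow> (real \<Rightarrow> real) \<Rightarrow> real set \<Rightarrow> bool" where
  "cuts_at_angle S p q r \<theta> x y K \<longleftrightarrow>
     (let m = (\<lambda>t. lorentz (partial_x S (x t) (y t)) (tangent S x y t));
          n = (\<lambda>t. lorentz_norm (partial_x S (x t) (y t)) * lorentz_norm (tangent S x y t))
      in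
       p = 1 \<and> q = 1 \<and> r = 1 \<and> (\<forall>t\<in>K. m t = n t * cos \<theta>) \<or>
       p = -1 \<and> q = 1 \<and> r = 1 \<and> (\<exists>\<epsilon>\<in>{1, -1}. \<forall>t\<in>K. m t = \<epsilon> * n t * cosh \<theta>) \<or>
       p = -1 \<and> q * r = -1 \<and> (\<exists>\<epsilon>\<in>{1, -1}. \<forall>t\<in>K. m t = \<epsilon> * n t * sinh \<theta>) \<or>
       p = -1 \<and> q = -1 \<and> r = -1 \<and> (\<forall>t\<in>K. m t = - (n t * cosh \<theta>)))"

definition loxodrome ::
  "(real \<Rightarrow> real \<Rightarrow> real^3) \<Rightarrow> real set \<Rightarrow> real \<Rightarrow> real \<Rightarrow> real \<Rightarrow> real \<Rightarrow>
   (real \<Rightarrow> real) \<Rightarrow> (real \<Rightarrow> real) \<Rightarrow> real set \<Rightarrow> bool" where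
  "loxodrome S J p q r \<theta> x y K \<longleftrightarrow>
     admissible_curve S J q x y K \<and> angle_range p q r \<theta> \<and> cuts_at_angle S p q r \<theta> x y K"

definition angle_coeff :: "real \<Rightarrow> real \<Rightarrow> real \<Rightarrow> real \<Rightarrow> real" where
  "angle_coeff p q r \<theta> = (if p = 1 then sin \<theta> else if q * r = 1 then sinh \<theta> else cosh \<theta>)"

(* The equation between the differentials dy and dx, evaluated along t \<mapsto> (x t, y t). The three
   inequalities say that the roots and quotients in it are meaningful: without them sqrt of a
   negative number and division by zero would still denote reals. *)
definition loxodrome_equation ::
  "(real \<Rightarrow> real) \<Rightarrow> (real \<Rightarrow> real) \<Rightarrow> (real \<Rightarrow> real) \<Rightarrow> real \<Rightarrow> real \<Rightarrow> real \<Rightarrow> real \<Rightarrow>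
   (real \<Rightarrow> real) \<Rightarrow> (real \<Rightarrow> real) \<Rightarrow> real \<Rightarrow> bool" where
  "loxodrome_equation f g C p q r \<theta> x y t \<longleftrightarrow>
     (let A = angle_coeff p q r \<theta>;
          D = p * (r * (deriv f (y t))\<^sup>2 - (deriv g (y t))\<^sup>2)
      in
       0 \<le> D \<and> C (y t) \<noteq> 0 \<and> 0 < q * r - p * A\<^sup>2 \<and>
       (\<exists>s\<in>{1, -1}. sqrt D / C (y t) * deriv y t = s * (A / sqrt (q * r - p * A\<^sup>2)) * deriv x t))"

end

theory Submission
  imports Defs
begin

text \<open>
  For \<open>b = 0\<close> all three surfaces arise from a planar profile curve by the rotations or boosts about
  an axis. Such a surface has a metric \<open>\<rho> (C\<^sup>2 dx\<^sup>2 + (\<rho> f'\<^sup>2 - g'\<^sup>2) dy\<^sup>2)\<close> without mixed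
  term and with coefficients that depend on \<open>y\<close> alone (\<open>revolution_metric\<close>); here \<open>\<rho> = r\<close> is the
  causal sign of the meridians, and \<open>D = p (r f'\<^sup>2 - g'\<^sup>2)\<close> is positive because the Gram
  determinant \<open>p C\<^sup>2 D\<close> has the sign \<open>p\<close>.

  In each case the angle condition reads \<open>m = \<plusminus> n c\<close>, where \<open>m\<close> is the product of \<open>\<Omega>\<^sub>x\<close> with the
  tangent \<open>T\<close>, \<open>n\<close> the product of their norms, and \<open>c\<close> is \<open>cos \<theta>\<close>, \<open>cosh \<theta>\<close> or \<open>sinh \<theta>\<close>. The
  Pythagorean identities combine into \<open>c\<^sup>2 = q r - p A\<^sup>2\<close>. Squaring \<open>m = r C\<^sup>2 dx/dt\<close> and inserting
  \<open>n\<^sup>2 = C\<^sup>2 q r (C\<^sup>2 (dx/dt)\<^sup>2 + p D (dy/dt)\<^sup>2)\<close>, one finds that \<open>\<bar>m\<bar> = n \<bar>c\<bar>\<close> is the same as the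
  differential equation (\<open>loxodrome_equation_iff\<close>).

  This proves the equation for every loxodrome. Conversely, the equation gives the angle condition up
  to a sign at each point. That sign is constant: it is determined by the sign of \<open>dx/dt\<close>, which by
  Darboux's theorem cannot change on an interval without a zero (\<open>angle_sign_constant\<close>). If it is
  not the sign which the angle condition prescribes, then the curve run through backwards has the
  right one.
\<close>

section \<open>Derivatives without zeros\<close>

text \<open>
  Where the derivative changes sign from plus to minus, the function exceeds both end values
  somewhere inside, so its maximum on the compact interval is an interior critical point. No
  continuity of the derivative is needed.
\<close>
lemma derivative_zero_between:
  fixes F F' :: "real \<Rightarrow> real"
  assumes "u < v"
    and der: "\<And>z. u \<le> z \<Longrightarrow> z \<le> v \<Longrightarrow> (F has_real_derivative F' z) (at z)"
    and "F' u > 0" and "F' v < 0"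
  shows "\<exists>z. u < z \<and> z < v \<and> F' z = 0"
proof -
  have cont: "continuous_on {u..v} F"
    by (meson DERIV_isCont atLeastAtMost_iff continuous_at_imp_continuous_on der)
  obtain z where z: "z \<in> {u..v}" and max: "\<And>w. w \<in> {u..v} \<Longrightarrow> F w \<le> F z"
    using continuous_attains_sup[OF _ _ cont] \<open>u < v\<close> by auto
  obtain d where d: "d > 0" "\<And>k. 0 < k \<Longrightarrow> k < d \<Longrightarrow> F u < F (u + k)"
    using DERIV_pos_inc_right[OF der[of u]] assms by auto
  obtain d' where d': "d' > 0" "\<And>k. 0 < k \<Longrightarrow> k < d' \<Longrightarrow> F v < F (v - k)"
    using DERIV_neg_dec_left[OF der[of v]] assms by auto
  have "z \<noteq> u"
  proof
    assume "z = u"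
    define k where "k = min (d / 2) (v - u)"
    have "0 < k" "k < d" "u + k \<in> {u..v}"
      using d(1) \<open>u < v\<close> by (auto simp: k_def min_def)
    with d(2) max \<open>z = u\<close> show False by (meson linorder_not_less)
  qed
  moreover have "z \<noteq> v"
  proof
    assume "z = v"
    define k where "k = min (d' / 2) (v - u)"
    have "0 < k" "k < d'" "v - k \<in> {u..v}"
      using d'(1) \<open>u < v\<close> by (auto simp: k_def min_def)
    with d'(2) max \<open>z = v\<close> show False by (meson linorder_not_less)
  qed
  ultimately have inside: "u < z" "z < v" using z by auto
  have "F' z = 0"
  proof (rule DERIV_local_max)
    show "DERIV F z :> F' z" using der inside by simp
    show "0 < min (z - u) (v - z)" using inside by simp
    show "\<forall>w. \<bar>z - w\<bar> < min (z - u) (v - z) \<longrightarrow> F w \<le> F z"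
      using max by (auto simp: abs_if split: if_splits)
  qed
  with inside show ?thesis by blast
qed

lemma nonzero_deriv_constant_sign:
  fixes F :: "real \<Rightarrow> real"
  assumes "is_interval K"
    and diff: "\<And>t. t \<in> K \<Longrightarrow> F differentiable (at t)"
    and nz: "\<And>t. t \<in> K \<Longrightarrow> deriv F t \<noteq> 0"
  shows "(\<forall>t\<in>K. deriv F t > 0) \<or> (\<forall>t\<in>K. deriv F t < 0)"
proof (rule ccontr)
  assume "\<not> ?thesis"
  then obtain s t where st: "s \<in> K" "t \<in> K" "deriv F s < 0" "deriv F t > 0"
    using nz by (meson linorder_neqE_linordered_idom)
  have sub: "z \<in> K" if "u \<in> K" "v \<in> K" "u \<le> z" "z \<le> v" for u v z
    using \<open>is_interval K\<close> that by (meson is_interval_1)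
  have der: "(F has_real_derivative deriv F z) (at z)" if "z \<in> K" for z
    using diff[OF that] by (simp add: DERIV_deriv_iff_real_differentiable)
  consider "t < s" | "s < t" using st by fastforce
  then show False
  proof cases
    case 1
    then show False
      using derivative_zero_between[of t s F "deriv F"] der sub[OF st(2) st(1)] st nz
      by (meson less_imp_le)
  next
    case 2
    have "\<exists>z. s < z \<and> z < t \<and> - deriv F z = 0"
      by (rule derivative_zero_between[where F = "\<lambda>z. - F z"])
        (use 2 st in \<open>auto intro!: DERIV_minus der sub[OF st(1,2)]\<close>)
    then show False using sub[OF st(1,2)] nz by (auto intro: less_imp_le)
  qed
qed

section \<open>The Lorentz product\<close>

lemma lorentz_add_left: "lorentz (u + v) w = lorentz u w + lorentz v w"
  and lorentz_add_right: "lorentz u (v + w) = lorentz u v + lorentz u w"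
  and lorentz_scale_left: "lorentz (k *\<^sub>R u) v = k * lorentz u v"
  and lorentz_scale_right: "lorentz u (k *\<^sub>R v) = k * lorentz u v"
  by (simp_all add: lorentz_def algebra_simps)

lemmas lorentz_linear =
  lorentz_add_left lorentz_add_right lorentz_scale_left lorentz_scale_right

lemma lorentz_zero [simp]: "lorentz 0 u = 0" "lorentz u 0 = 0"
  by (simp_all add: lorentz_def)

lemma lorentz_minus [simp]:
  "lorentz (- u) v = - lorentz u v" "lorentz u (- v) = - lorentz u v"
  by (simp_all add: lorentz_def)

lemma lorentz_commute: "lorentz u v = lorentz v u"
  by (simp add: lorentz_def)

section \<open>The three cases of the angle condition\<close>

text \<open>
  The function of \<open>\<theta>\<close> that multiplies the two norms in the angle condition; \<open>angle_coeff\<close> is its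
  companion under the circular or hyperbolic Pythagorean identity.
\<close>
definition angle_factor :: "real \<Rightarrow> real \<Rightarrow> real \<Rightarrow> real \<Rightarrow> real" where
  "angle_factor p q r \<theta> = (if p = 1 then cos \<theta> else if q * r = 1 then cosh \<theta> else sinh \<theta>)"

lemma angle_factor_square:
  assumes "angle_range p q r \<theta>"
  shows "q * r - p * (angle_coeff p q r \<theta>)\<^sup>2 = (angle_factor p q r \<theta>)\<^sup>2"
  using assms cosh_square_eq[of \<theta>]
  by (auto simp: angle_range_def angle_coeff_def angle_factor_def cos_squared_eq)

text \<open>
  The sign in the angle condition is prescribed when loxodrome and meridians are spacelike on a
  spacelike surface or timelike on a timelike one; in the other cases it may be either sign.
\<close>
lemma cuts_at_angle_signI:
  assumes "angle_range p q r \<theta>" and "\<sigma> \<in> {1, -1}"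
    and "p = 1 \<Longrightarrow> \<sigma> = 1" and "q = -1 \<and> r = -1 \<Longrightarrow> \<sigma> = -1"
    and "\<And>t. t \<in> K \<Longrightarrow> lorentz (partial_x S (x t) (y t)) (tangent S x y t) =
      \<sigma> * (lorentz_norm (partial_x S (x t) (y t)) * lorentz_norm (tangent S x y t))
        * angle_factor p q r \<theta>"
  shows "cuts_at_angle S p q r \<theta> x y K"
proof -
  consider "p = 1" "q = 1" "r = 1" | "p = -1" "q = 1" "r = 1" | "p = -1" "q * r = -1"
    | "p = -1" "q = -1" "r = -1"
    using assms(1) by (auto simp: angle_range_def)
  then show ?thesis
    by cases (use assms(2-5) in \<open>auto simp: cuts_at_angle_def Let_def angle_factor_def\<close>)
qed

lemma cuts_at_angle_abs:
  assumes "cuts_at_angle S p q r \<theta> x y K" and "t \<in> K"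
  shows "\<bar>lorentz (partial_x S (x t) (y t)) (tangent S x y t)\<bar> =
    lorentz_norm (partial_x S (x t) (y t)) * lorentz_norm (tangent S x y t)
      * \<bar>angle_factor p q r \<theta>\<bar>"
proof -
  have "lorentz_norm u \<ge> 0" for u by (simp add: lorentz_norm_def)
  then show ?thesis
    using assms by (auto simp: cuts_at_angle_def Let_def angle_factor_def abs_mult)
qed

text \<open>
  Both sides compare squares. Writing \<open>k = q r\<close>, the right-hand side says
  \<open>C\<^sup>2 X\<^sup>2 = k (C\<^sup>2 X\<^sup>2 + p D Y\<^sup>2) c\<^sup>2\<close>; as \<open>k\<^sup>2 = 1\<close> and \<open>1 - k c\<^sup>2 = k p A\<^sup>2\<close>, solving for
  \<open>X\<^sup>2\<close> leaves \<open>A\<^sup>2 C\<^sup>2 X\<^sup>2 = c\<^sup>2 D Y\<^sup>2\<close>, the square of the left-hand side. Since \<open>X \<noteq> 0\<close>, the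
  right-hand side also forces \<open>c \<noteq> 0\<close>.
\<close>
lemma separated_equation_iff:
  fixes A C D N X Y c p q r :: real
  assumes signs: "p \<in> {1, -1}" "q \<in> {1, -1}" "r \<in> {1, -1}"
    and "C \<noteq> 0" "D > 0" "X \<noteq> 0" "N > 0"
    and N: "N = q * (r * C\<^sup>2 * X\<^sup>2 + r * p * D * Y\<^sup>2)"
    and A: "q * r - p * A\<^sup>2 = c\<^sup>2"
  shows "(c \<noteq> 0 \<and> (\<exists>s\<in>{1, -1}. sqrt D / C * Y = s * (A / \<bar>c\<bar>) * X)) \<longleftrightarrow>
    \<bar>r * C\<^sup>2 * X\<bar> = \<bar>C\<bar> * sqrt N * \<bar>c\<bar>"
proof -
  have rhs: "\<bar>r * C\<^sup>2 * X\<bar> = \<bar>C\<bar> * sqrt N * \<bar>c\<bar> \<longleftrightarrow> C\<^sup>2 * X\<^sup>2 = N * c\<^sup>2"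
  proof -
    have "\<bar>r * C\<^sup>2 * X\<bar> = \<bar>C\<bar> * sqrt N * \<bar>c\<bar> \<longleftrightarrow> \<bar>r * C\<^sup>2 * X\<bar> = \<bar>C * sqrt N * c\<bar>"
      using \<open>N > 0\<close> by (simp add: abs_mult)
    also have "\<dots> \<longleftrightarrow> (r * C\<^sup>2 * X)\<^sup>2 = (C * sqrt N * c)\<^sup>2"
      by (simp only: abs_eq_iff power2_eq_iff)
    also have "\<dots> \<longleftrightarrow> C\<^sup>2 * (C\<^sup>2 * X\<^sup>2) = C\<^sup>2 * (N * c\<^sup>2)"
      using \<open>N > 0\<close> signs(3) by (auto simp: power_mult_distrib power2_eq_square ac_simps)
    also have "\<dots> \<longleftrightarrow> C\<^sup>2 * X\<^sup>2 = N * c\<^sup>2"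
      using \<open>C \<noteq> 0\<close> by (simp only: mult_cancel_left power_eq_0_iff) simp
    finally show ?thesis .
  qed
  show ?thesis
  proof (cases "c = 0")
    case True
    with rhs \<open>C \<noteq> 0\<close> \<open>X \<noteq> 0\<close> show ?thesis by auto
  next
    case False
    have "(\<exists>s\<in>{1, -1}. sqrt D / C * Y = s * (A / \<bar>c\<bar>) * X) \<longleftrightarrow>
        \<bar>sqrt D / C * Y\<bar> = \<bar>A / \<bar>c\<bar> * X\<bar>"
      by (simp only: abs_eq_iff) simp
    also have "\<dots> \<longleftrightarrow> (sqrt D / C * Y)\<^sup>2 = (A / \<bar>c\<bar> * X)\<^sup>2"
      by (simp only: abs_eq_iff power2_eq_iff)
    also have "\<dots> \<longleftrightarrow> A\<^sup>2 * C\<^sup>2 * X\<^sup>2 = c\<^sup>2 * D * Y\<^sup>2"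
      using \<open>D > 0\<close> \<open>C \<noteq> 0\<close> False by (auto simp: power_mult_distrib power_divide field_simps)
    also have "\<dots> \<longleftrightarrow> C\<^sup>2 * X\<^sup>2 = N * c\<^sup>2"
    proof -
      have "C\<^sup>2 * X\<^sup>2 - N * c\<^sup>2 = q * r * p * (A\<^sup>2 * C\<^sup>2 * X\<^sup>2 - c\<^sup>2 * D * Y\<^sup>2)"
        using signs unfolding N A[symmetric] by (auto simp: algebra_simps)
      with signs show ?thesis by auto
    qed
    finally show ?thesis using rhs False by simp
  qed
qed

section \<open>Surfaces with a diagonal metric that depends on one parameter\<close>

text \<open>
  What the untwisted surfaces of the three types have in common. The metric is
  \<open>\<rho> (C\<^sup>2 dx\<^sup>2 + (\<rho> f'\<^sup>2 - g'\<^sup>2) dy\<^sup>2)\<close>, where \<open>\<rho>\<close> is the causal sign of the meridians.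
\<close>
locale revolution_metric =
  fixes S :: "real \<Rightarrow> real \<Rightarrow> real^3" and J :: "real set" and f g C :: "real \<Rightarrow> real" and \<rho> :: real
  assumes meridian: "\<rho> \<in> {1, -1}"
    and metric_xx:
      "y \<in> J \<Longrightarrow> lorentz (partial_x S x y) (partial_x S x y) = \<rho> * (C y)\<^sup>2"
    and metric_xy: "y \<in> J \<Longrightarrow> lorentz (partial_x S x y) (partial_y S x y) = 0"
    and metric_yy:
      "y \<in> J \<Longrightarrow> lorentz (partial_y S x y) (partial_y S x y) =
        \<rho> * (\<rho> * (deriv f y)\<^sup>2 - (deriv g y)\<^sup>2)"
    and curve_derivative:
      "\<lbrakk>Y t \<in> J; X differentiable (at t); Y differentiable (at t)\<rbrakk> \<Longrightarrow>
        ((\<lambda>t. S (X t) (Y t)) has_vector_derivative tangent S X Y t) (at t)"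
begin

lemma gram_det_eq:
  assumes "y \<in> J"
  shows "gram_det S x y = (C y)\<^sup>2 * (\<rho> * (deriv f y)\<^sup>2 - (deriv g y)\<^sup>2)"
  using meridian by (auto simp: gram_det_def metric_xx metric_xy metric_yy assms)

lemma surface_sign_positive:
  assumes "surface_sign p S J" and "y \<in> J"
  shows "p \<in> {1, -1}" and "C y \<noteq> 0" and "p * (\<rho> * (deriv f y)\<^sup>2 - (deriv g y)\<^sup>2) > 0"
proof -
  from assms show p: "p \<in> {1, -1}" by (auto simp: surface_sign_def)
  have "p * gram_det S 0 y > 0"
    using assms by (auto simp: surface_sign_def spacelike_surface_def timelike_surface_def)
  then have "(C y)\<^sup>2 * (p * (\<rho> * (deriv f y)\<^sup>2 - (deriv g y)\<^sup>2)) > 0"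
    by (simp add: gram_det_eq[OF assms(2)] algebra_simps)
  then show "C y \<noteq> 0" and "p * (\<rho> * (deriv f y)\<^sup>2 - (deriv g y)\<^sup>2) > 0"
    by (auto simp: zero_less_mult_iff)
qed

lemma meridian_sign_unique:
  assumes "surface_sign p S J" and "meridian_sign r S J" and "y \<in> J"
  shows "r = \<rho>"
proof -
  have nz: "lorentz (partial_x S 0 y) (partial_x S 0 y) = \<rho> * (C y)\<^sup>2" "(C y)\<^sup>2 > 0"
    using metric_xx assms(3) surface_sign_positive(2)[OF assms(1,3)] by auto
  then have "partial_x S 0 y \<noteq> 0" using meridian by auto
  moreover have "r = 1 \<and> spacelike (partial_x S 0 y) \<or> r = -1 \<and> timelike (partial_x S 0 y)"
    using assms(2,3) by (auto simp: meridian_sign_def curve_sign_def spacelike_curve_def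
      timelike_curve_def partial_x_def)
  ultimately show ?thesis
    using nz meridian by (auto simp: spacelike_def timelike_def)
qed

lemma lorentz_meridian_tangent:
  assumes "Y t \<in> J"
  shows "lorentz (partial_x S (X t) (Y t)) (tangent S X Y t) = \<rho> * (C (Y t))\<^sup>2 * deriv X t"
  by (simp add: tangent_def lorentz_linear metric_xx metric_xy assms)

lemma lorentz_tangent_tangent:
  assumes "Y t \<in> J"
  shows "lorentz (tangent S X Y t) (tangent S X Y t) =
    \<rho> * (C (Y t))\<^sup>2 * (deriv X t)\<^sup>2
      + \<rho> * (\<rho> * (deriv f (Y t))\<^sup>2 - (deriv g (Y t))\<^sup>2) * (deriv Y t)\<^sup>2"
proof -
  have "lorentz (partial_y S (X t) (Y t)) (partial_x S (X t) (Y t)) = 0"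
    using metric_xy[OF assms] by (simp add: lorentz_commute)
  then show ?thesis
    by (simp add: tangent_def lorentz_linear metric_xx[OF assms] metric_xy[OF assms]
      metric_yy[OF assms] power2_eq_square algebra_simps)
qed

lemma norm_meridian:
  assumes "y \<in> J"
  shows "lorentz_norm (partial_x S x y) = \<bar>C y\<bar>"
  using meridian by (auto simp: lorentz_norm_def metric_xx[OF assms])

lemma admissible_tangent:
  assumes "surface_sign p S J" and "admissible_curve S J q X Y K" and "t \<in> K"
  shows "q \<in> {1, -1}" and "Y t \<in> J" and "deriv X t \<noteq> 0"
    and "q * lorentz (tangent S X Y t) (tangent S X Y t) > 0"
    and "vector_derivative (\<lambda>t. S (X t) (Y t)) (at t) = tangent S X Y t"
proof -
  from assms(2,3) show Y: "Y t \<in> J" and X: "deriv X t \<noteq> 0" and "q \<in> {1, -1}"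
    by (auto simp: admissible_curve_def curve_sign_def)
  show vd: "vector_derivative (\<lambda>t. S (X t) (Y t)) (at t) = tangent S X Y t"
    by (rule vector_derivative_at, rule curve_derivative)
      (use assms(2,3) in \<open>auto simp: admissible_curve_def\<close>)
  have "lorentz (partial_x S (X t) (Y t)) (tangent S X Y t) \<noteq> 0"
    using lorentz_meridian_tangent[of Y t X, OF Y] meridian X
      surface_sign_positive(2)[OF assms(1) Y] by auto
  then have "tangent S X Y t \<noteq> 0" by auto
  with assms(2,3) show "q * lorentz (tangent S X Y t) (tangent S X Y t) > 0"
    by (auto simp: admissible_curve_def curve_sign_def spacelike_curve_def timelike_curve_def
      spacelike_def timelike_def vd)
qed

text \<open>The differential equation is the angle condition with its sign forgotten.\<close>
lemma loxodrome_equation_iff: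
  assumes surf: "surface_sign p S J" and adm: "admissible_curve S J q X Y K" and t: "t \<in> K"
    and ang: "angle_range p q \<rho> \<theta>"
  shows "loxodrome_equation f g C p q \<rho> \<theta> X Y t \<longleftrightarrow>
    \<bar>lorentz (partial_x S (X t) (Y t)) (tangent S X Y t)\<bar> =
      lorentz_norm (partial_x S (X t) (Y t)) * lorentz_norm (tangent S X Y t)
        * \<bar>angle_factor p q \<rho> \<theta>\<bar>"
proof -
  note adm_t = admissible_tangent[OF surf adm t]
  note Y = adm_t(2)
  note pos = surface_sign_positive[OF surf Y]
  define D where "D = p * (\<rho> * (deriv f (Y t))\<^sup>2 - (deriv g (Y t))\<^sup>2)"
  define c where "c = angle_factor p q \<rho> \<theta>"
  define A where "A = angle_coeff p q \<rho> \<theta>"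
  define N where "N = q * lorentz (tangent S X Y t) (tangent S X Y t)"
  have N: "N = q * (\<rho> * (C (Y t))\<^sup>2 * (deriv X t)\<^sup>2 + \<rho> * p * D * (deriv Y t)\<^sup>2)"
    using pos(1) by (auto simp: N_def D_def lorentz_tangent_tangent[of Y t X, OF Y])
  have normT: "lorentz_norm (tangent S X Y t) = sqrt N"
    using adm_t(1,4) by (auto simp: lorentz_norm_def N_def)
  have A: "q * \<rho> - p * A\<^sup>2 = c\<^sup>2"
    unfolding A_def c_def by (rule angle_factor_square[OF ang])
  have "loxodrome_equation f g C p q \<rho> \<theta> X Y t \<longleftrightarrow>
      c \<noteq> 0 \<and> (\<exists>s\<in>{1, -1}. sqrt D / C (Y t) * deriv Y t = s * (A / \<bar>c\<bar>) * deriv X t)"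
    unfolding loxodrome_equation_def Let_def A_def[symmetric] D_def[symmetric] A
    using pos by (simp add: D_def less_imp_le)
  also have "\<dots> \<longleftrightarrow> \<bar>\<rho> * (C (Y t))\<^sup>2 * deriv X t\<bar> = \<bar>C (Y t)\<bar> * sqrt N * \<bar>c\<bar>"
    by (rule separated_equation_iff[OF pos(1) adm_t(1) meridian pos(2) _ adm_t(3) _ N A])
      (use pos(3) adm_t(4) in \<open>auto simp: D_def N_def\<close>)
  finally show ?thesis
    by (simp add: normT norm_meridian[OF Y] lorentz_meridian_tangent[of Y t X, OF Y] c_def)
qed

text \<open>
  The product of \<open>\<Omega>\<^sub>x\<close> and the tangent is a nonzero multiple of \<open>dx/dt\<close>, whose sign cannot
  change; so the sign lost in the differential equation is the same at all points of the curve.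
\<close>
lemma angle_sign_constant:
  assumes surf: "surface_sign p S J" and adm: "admissible_curve S J q X Y K"
    and abs: "\<And>t. t \<in> K \<Longrightarrow> \<bar>lorentz (partial_x S (X t) (Y t)) (tangent S X Y t)\<bar> =
      lorentz_norm (partial_x S (X t) (Y t)) * lorentz_norm (tangent S X Y t) * \<bar>c\<bar>"
  obtains \<sigma> :: real where "\<sigma> \<in> {1, -1}"
    and "\<And>t. t \<in> K \<Longrightarrow> lorentz (partial_x S (X t) (Y t)) (tangent S X Y t) =
      \<sigma> * (lorentz_norm (partial_x S (X t) (Y t)) * lorentz_norm (tangent S X Y t)) * c"
proof -
  have "(\<forall>t\<in>K. deriv X t > 0) \<or> (\<forall>t\<in>K. deriv X t < 0)"
    by (rule nonzero_deriv_constant_sign) (use adm in \<open>auto simp: admissible_curve_def\<close>)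
  then obtain \<tau> :: real where \<tau>: "\<tau> \<in> {1, -1}" "\<And>t. t \<in> K \<Longrightarrow> \<bar>deriv X t\<bar> = \<tau> * deriv X t"
    by (metis abs_of_neg abs_of_pos insertCI mult_1 mult_minus1)
  define \<sigma> where "\<sigma> = \<rho> * \<tau> * (if c < 0 then -1 else 1)"
  show thesis
  proof (rule that)
    show "\<sigma> \<in> {1, -1}" using \<tau>(1) meridian by (auto simp: \<sigma>_def)
    fix t assume t: "t \<in> K"
    let ?m = "lorentz (partial_x S (X t) (Y t)) (tangent S X Y t)"
    have "\<bar>?m\<bar> = \<rho> * \<tau> * ?m"
      using meridian \<tau>(2)[OF t]
      by (auto simp: lorentz_meridian_tangent[of Y t X, OF admissible_tangent(2)[OF surf adm t]]
        abs_mult)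
    then have "?m = \<rho> * \<tau> * \<bar>?m\<bar>" using meridian \<tau>(1) by auto
    also have "\<dots> =
      \<sigma> * (lorentz_norm (partial_x S (X t) (Y t)) * lorentz_norm (tangent S X Y t)) * c"
      unfolding abs[OF t] \<sigma>_def by simp
    finally show "?m =
      \<sigma> * (lorentz_norm (partial_x S (X t) (Y t)) * lorentz_norm (tangent S X Y t)) * c" .
  qed
qed

end

section \<open>Reversing a curve\<close>

lemma differentiable_reflect:
  fixes F :: "real \<Rightarrow> real"
  assumes "F differentiable (at (- t))"
  shows "(\<lambda>t. F (- t)) differentiable (at t)" and "deriv (\<lambda>t. F (- t)) t = - deriv F (- t)"
proof -
  have "((\<lambda>t. F (- t)) has_real_derivative deriv F (- t) * (- 1)) (at t)"
    by (rule DERIV_chain2[where g = uminus])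
      (use assms in \<open>auto simp: DERIV_deriv_iff_real_differentiable intro!: derivative_eq_intros\<close>)
  then show "(\<lambda>t. F (- t)) differentiable (at t)" "deriv (\<lambda>t. F (- t)) t = - deriv F (- t)"
    by (auto simp: real_differentiable_def dest: DERIV_imp_deriv)
qed

text \<open>
  The tangent changes its sign and keeps its norm, so reversal turns the angle condition with one
  sign into the angle condition with the other.
\<close>
lemma tangent_reflect:
  assumes "X differentiable (at (- t))" and "Y differentiable (at (- t))"
  shows "tangent S (\<lambda>t. X (- t)) (\<lambda>t. Y (- t)) t = - tangent S X Y (- t)"
  by (simp add: tangent_def differentiable_reflect(2)[OF assms(1)]
    differentiable_reflect(2)[OF assms(2)])

lemma (in revolution_metric) admissible_reflect:
  assumes "surface_sign p S J" and adm: "admissible_curve S J q X Y K"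
  shows "admissible_curve S J q (\<lambda>t. X (- t)) (\<lambda>t. Y (- t)) (uminus ` K)"
proof -
  have K: "K \<noteq> {}" "open K" "is_interval K"
    and XY: "\<And>t. t \<in> K \<Longrightarrow> Y t \<in> J \<and> X differentiable (at t) \<and> Y differentiable (at t)
      \<and> deriv X t \<noteq> 0"
    and sign: "curve_sign q (\<lambda>t. S (X t) (Y t)) K"
    using adm by (auto simp: admissible_curve_def)
  have vd: "vector_derivative (\<lambda>t. S (X (- t)) (Y (- t))) (at (- t)) =
      - vector_derivative (\<lambda>t. S (X t) (Y t)) (at t)" if t: "t \<in> K" for t
  proof -
    have "vector_derivative (\<lambda>t. S (X (- t)) (Y (- t))) (at (- t)) =
        tangent S (\<lambda>t. X (- t)) (\<lambda>t. Y (- t)) (- t)"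
      by (rule vector_derivative_at, rule curve_derivative)
        (use XY[OF t] in \<open>auto intro!: differentiable_reflect(1)\<close>)
    also have "\<dots> = - tangent S X Y t"
      using XY[OF t] by (simp add: tangent_reflect)
    finally show ?thesis by (simp add: admissible_tangent(5)[OF assms(1) adm t])
  qed
  have "curve_sign q (\<lambda>t. S (X (- t)) (Y (- t))) (uminus ` K)"
    using sign by (auto simp: curve_sign_def spacelike_curve_def timelike_curve_def spacelike_def
      timelike_def vd)
  moreover have "is_interval (uminus ` K)"
    using K(3) by (rule is_interval_uminusI)
  ultimately show ?thesis
    using K XY by (auto simp: admissible_curve_def open_negations differentiable_reflect)
qed

section \<open>Untwisted surfaces are surfaces of revolution\<close>

text \<open>
  The common form of the three types for \<open>b = 0\<close>: the profile curve \<open>(C, h)\<close> is written in the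
  orthogonal frame of a moving vector \<open>e\<close> and the fixed axis \<open>w\<close>, and \<open>e\<close> runs through an orbit
  of the rotations or boosts about this axis.
\<close>
lemma revolution_metricI:
  fixes e e' :: "real \<Rightarrow> real^3"
  assumes S: "\<And>x y. S x y = C y *\<^sub>R e x + h y *\<^sub>R w"
    and e: "\<And>x. (e has_vector_derivative e' x) (at x)"
    and C: "\<And>y. y \<in> J \<Longrightarrow> (C has_real_derivative C' y) (at y)"
    and h: "\<And>y. y \<in> J \<Longrightarrow> (h has_real_derivative h' y) (at y)"
    and "\<rho> \<in> {1, -1}" and "\<And>x. lorentz (e' x) (e' x) = \<rho>"
    and "\<And>x. lorentz (e' x) (e x) = 0" and "\<And>x. lorentz (e' x) w = 0"
    and "\<And>x. lorentz (e x) w = 0"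
    and profile: "\<And>x y. y \<in> J \<Longrightarrow> (C' y)\<^sup>2 * lorentz (e x) (e x) + (h' y)\<^sup>2 * lorentz w w =
      \<rho> * (\<rho> * (deriv f y)\<^sup>2 - (deriv g y)\<^sup>2)"
  shows "revolution_metric S J f g C \<rho>"
proof -
  have px: "partial_x S x y = C y *\<^sub>R e' x" for x y
    unfolding partial_x_def S
    using has_vector_derivative_add[OF bounded_linear.has_vector_derivative[OF
        bounded_linear_scaleR_right e] has_vector_derivative_const]
    by (intro vector_derivative_at) simp
  have py: "partial_y S x y = C' y *\<^sub>R e x + h' y *\<^sub>R w" if "y \<in> J" for x y
    unfolding partial_y_def S
    using has_vector_derivative_add[OF
        has_vector_derivative_scaleR[OF C[OF that] has_vector_derivative_const]
        has_vector_derivative_scaleR[OF h[OF that] has_vector_derivative_const]]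
    by (intro vector_derivative_at) simp
  have we: "lorentz w (e x) = 0" for x
    using assms(9) by (simp add: lorentz_commute)
  show ?thesis
  proof
    show "((\<lambda>t. S (X t) (Y t)) has_vector_derivative tangent S X Y t) (at t)"
      if Y: "Y t \<in> J" and "X differentiable (at t)" and "Y differentiable (at t)" for X Y t
    proof -
      have X': "(X has_real_derivative deriv X t) (at t)"
        and Y': "(Y has_real_derivative deriv Y t) (at t)"
        using that by (simp_all add: DERIV_deriv_iff_real_differentiable)
      have "((\<lambda>t. e (X t)) has_vector_derivative deriv X t *\<^sub>R e' (X t)) (at t)"
        using vector_diff_chain_at[OF X'[unfolded has_real_derivative_iff_has_vector_derivative] e]
        by (simp add: o_def)
      then have "((\<lambda>t. C (Y t) *\<^sub>R e (X t) + h (Y t) *\<^sub>R w) has_vector_derivative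
          (C (Y t) *\<^sub>R (deriv X t *\<^sub>R e' (X t)) + (C' (Y t) * deriv Y t) *\<^sub>R e (X t))
            + (h (Y t) *\<^sub>R 0 + (h' (Y t) * deriv Y t) *\<^sub>R w)) (at t)"
        by (intro has_vector_derivative_add has_vector_derivative_scaleR
          has_vector_derivative_const DERIV_chain2[OF C[OF Y] Y'] DERIV_chain2[OF h[OF Y] Y'])
      then show ?thesis
        by (simp add: S tangent_def px py[OF Y] algebra_simps)
    qed
  qed (use assms(5-9) profile in
      \<open>auto simp: px py lorentz_linear we power2_eq_square algebra_simps\<close>)
qed

lemma smooth_fun_on_has_deriv:
  assumes "smooth_fun_on J f" and "y \<in> J"
  shows "(f has_real_derivative deriv f y) (at y)"
proof -
  from assms have "(deriv ^^ 0) f differentiable (at y)" unfolding smooth_fun_on_def by blast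
  then show ?thesis by (simp add: DERIV_deriv_iff_real_differentiable)
qed

lemma has_vector_derivative_vector_3:
  assumes "(f has_real_derivative f') (at x)" "(g has_real_derivative g') (at x)"
    and "(h has_real_derivative h') (at x)"
  shows "((\<lambda>x. vector [f x, g x, h x] :: real^3) has_vector_derivative vector [f', g', h']) (at x)"
proof -
  have v: "vector [a, b, c] = a *\<^sub>R axis 1 1 + b *\<^sub>R axis 2 1 + c *\<^sub>R (axis 3 1 :: real^3)"
    for a b c :: real
    by (simp add: vec_eq_iff forall_3 axis_def)
  show ?thesis
    unfolding v using assms by (auto intro!: derivative_eq_intros)
qed

lemma cosh_mult_self: "cosh x * cosh x = sinh x * sinh x + (1 :: real)"
  using cosh_square_eq[of x] by (simp add: power2_eq_square)

lemma twisted_I_metric: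
  assumes "smooth_fun_on J f" and "smooth_fun_on J g"
  shows "revolution_metric (twisted_I a 0 f g) J f g (\<lambda>y. a + f y) 1"
proof (rule revolution_metricI[where e = "\<lambda>x. vector [cos x, sin x, 0]"
      and e' = "\<lambda>x. vector [- sin x, cos x, 0]" and w = "vector [0, 0, 1]" and h = g])
  show "twisted_I a 0 f g x y =
      (a + f y) *\<^sub>R vector [cos x, sin x, 0] + g y *\<^sub>R vector [0, 0, 1]" for x y
    by (simp add: twisted_I_def vec_eq_iff forall_3)
  show "((\<lambda>x. vector [cos x, sin x, 0] :: real^3) has_vector_derivative
      vector [- sin x, cos x, 0]) (at x)" for x :: real
    by (rule has_vector_derivative_vector_3) (auto intro!: derivative_eq_intros)
  show "((\<lambda>y. a + f y) has_real_derivative deriv f y) (at y)"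
    and "(g has_real_derivative deriv g y) (at y)" if "y \<in> J" for y
    using that assms by (auto intro!: derivative_eq_intros smooth_fun_on_has_deriv)
qed (auto simp: lorentz_def simp flip: power2_eq_square)

lemma twisted_II_metric:
  assumes "smooth_fun_on J f" and "smooth_fun_on J g"
  shows "revolution_metric (twisted_II a 0 f g) J f g (\<lambda>y. a + g y) 1"
proof (rule revolution_metricI[where e = "\<lambda>x. vector [0, sinh x, cosh x]"
      and e' = "\<lambda>x. vector [0, cosh x, sinh x]" and w = "vector [1, 0, 0]" and h = f])
  show "twisted_II a 0 f g x y =
      (a + g y) *\<^sub>R vector [0, sinh x, cosh x] + f y *\<^sub>R vector [1, 0, 0]" for x y
    by (simp add: twisted_II_def vec_eq_iff forall_3)
  show "((\<lambda>x. vector [0, sinh x, cosh x] :: real^3) has_vector_derivative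
      vector [0, cosh x, sinh x]) (at x)" for x :: real
    by (rule has_vector_derivative_vector_3) (auto intro!: derivative_eq_intros)
  show "((\<lambda>y. a + g y) has_real_derivative deriv g y) (at y)"
    and "(f has_real_derivative deriv f y) (at y)" if "y \<in> J" for y
    using that assms by (auto intro!: derivative_eq_intros smooth_fun_on_has_deriv)
qed (auto simp: lorentz_def cosh_mult_self algebra_simps)

lemma twisted_III_metric:
  assumes "smooth_fun_on J f" and "smooth_fun_on J g"
  shows "revolution_metric (twisted_III a 0 f g) J f g (\<lambda>y. a + f y) (-1)"
proof (rule revolution_metricI[where e = "\<lambda>x. vector [cosh x, 0, sinh x]"
      and e' = "\<lambda>x. vector [sinh x, 0, cosh x]" and w = "vector [0, 1, 0]" and h = g])
  show "twisted_III a 0 f g x y =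
      (a + f y) *\<^sub>R vector [cosh x, 0, sinh x] + g y *\<^sub>R vector [0, 1, 0]" for x y
    by (simp add: twisted_III_def vec_eq_iff forall_3)
  show "((\<lambda>x. vector [cosh x, 0, sinh x] :: real^3) has_vector_derivative
      vector [sinh x, 0, cosh x]) (at x)" for x :: real
    by (rule has_vector_derivative_vector_3) (auto intro!: derivative_eq_intros)
  show "((\<lambda>y. a + f y) has_real_derivative deriv f y) (at y)"
    and "(g has_real_derivative deriv g y) (at y)" if "y \<in> J" for y
    using that assms by (auto intro!: derivative_eq_intros smooth_fun_on_has_deriv)
qed (auto simp: lorentz_def cosh_mult_self algebra_simps)

section \<open>The differential equation of the loxodromes\<close>

theorem theorem5:
  fixes a p q r \<theta> :: real
    and f g C x y :: "real \<Rightarrow> real"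
    and S :: "real \<Rightarrow> real \<Rightarrow> real^3"
    and J K :: "real set"
  assumes "open J" and "is_interval J"
    and "smooth_fun_on J f" and "smooth_fun_on J g"
    and "(S = twisted_I a 0 f g \<and> C = (\<lambda>y. a + f y) \<and>
            \<not> (p = -1 \<and> q = 1 \<and> r = -1) \<and> \<not> (p = -1 \<and> q = -1 \<and> r = -1)) \<or>
         (S = twisted_II a 0 f g \<and> C = (\<lambda>y. a + g y) \<and>
            \<not> (p = -1 \<and> q = 1 \<and> r = -1) \<and> \<not> (p = -1 \<and> q = -1 \<and> r = -1)) \<or>
         (S = twisted_III a 0 f g \<and> C = (\<lambda>y. a + f y) \<and>
            \<not> (p = 1 \<and> q = 1 \<and> r = 1) \<and> \<not> (p = -1 \<and> q = 1 \<and> r = 1) \<and>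
            \<not> (p = -1 \<and> q = -1 \<and> r = 1))"
    and "surface_sign p S J" and "meridian_sign r S J"
    and "admissible_curve S J q x y K"
  shows "(loxodrome S J p q r \<theta> x y K \<longrightarrow>
            (\<forall>t\<in>K. loxodrome_equation f g C p q r \<theta> x y t)) \<and>
         (angle_range p q r \<theta> \<and> (\<forall>t\<in>K. loxodrome_equation f g C p q r \<theta> x y t) \<longrightarrow>
            loxodrome S J p q r \<theta> x y K \<or>
            loxodrome S J p q r \<theta> (\<lambda>t. x (- t)) (\<lambda>t. y (- t)) (uminus ` K))"
proof -
  obtain \<rho> where "revolution_metric S J f g C \<rho>"
    using assms(5) twisted_I_metric[OF assms(3,4)] twisted_II_metric[OF assms(3,4)]
      twisted_III_metric[OF assms(3,4)] by blast
  then interpret revolution_metric S J f g C \<rho> .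
  note surf = assms(6) and adm = assms(8)
  obtain t\<^sub>0 where "y t\<^sub>0 \<in> J" using adm by (auto simp: admissible_curve_def)
  then have r: "\<rho> = r" using meridian_sign_unique[OF surf assms(7)] by simp
  note eq_iff = loxodrome_equation_iff[OF surf adm, unfolded r]
  let ?m = "\<lambda>x y t. lorentz (partial_x S (x t) (y t)) (tangent S x y t)"
  let ?n = "\<lambda>x y t. lorentz_norm (partial_x S (x t) (y t)) * lorentz_norm (tangent S x y t)"
  let ?c = "angle_factor p q r \<theta>"
  have forward: "loxodrome_equation f g C p q r \<theta> x y t"
    if "loxodrome S J p q r \<theta> x y K" "t \<in> K" for t
  proof -
    from that(1) have "angle_range p q r \<theta>" and "cuts_at_angle S p q r \<theta> x y K"
      by (simp_all add: loxodrome_def)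
    then show ?thesis using eq_iff cuts_at_angle_abs that(2) by blast
  qed
  have backward: "loxodrome S J p q r \<theta> x y K \<or>
      loxodrome S J p q r \<theta> (\<lambda>t. x (- t)) (\<lambda>t. y (- t)) (uminus ` K)"
    if ang: "angle_range p q r \<theta>" and eq: "\<forall>t\<in>K. loxodrome_equation f g C p q r \<theta> x y t"
  proof -
    have "\<bar>?m x y t\<bar> = ?n x y t * \<bar>?c\<bar>" if "t \<in> K" for t
      using eq_iff[OF that ang] eq that by blast
    then obtain \<sigma> where \<sigma>: "\<sigma> \<in> {1, -1}" "\<And>t. t \<in> K \<Longrightarrow> ?m x y t = \<sigma> * ?n x y t * ?c"
      using angle_sign_constant[OF surf adm] by blast
    \<comment> \<open>the sign that the angle condition asks for, which is \<open>\<sigma>\<close> itself where it is free\<close>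
    define \<sigma>' where "\<sigma>' = (if p = 1 then 1 else if q = -1 \<and> r = -1 then -1 else \<sigma>)"
    have \<sigma>': "\<sigma>' \<in> {1, -1}" "p = 1 \<Longrightarrow> \<sigma>' = 1" "q = -1 \<and> r = -1 \<Longrightarrow> \<sigma>' = -1"
      using \<sigma>(1) ang by (auto simp: \<sigma>'_def angle_range_def)
    consider "\<sigma>' = \<sigma>" | "\<sigma>' = - \<sigma>" using \<sigma>(1) \<sigma>'(1) by auto
    then show ?thesis
    proof cases
      case 1
      have "cuts_at_angle S p q r \<theta> x y K"
        by (rule cuts_at_angle_signI[OF ang \<sigma>']) (use \<sigma>(2) 1 in auto)
      then show ?thesis using ang adm by (simp add: loxodrome_def)
    next
      case 2
      have "cuts_at_angle S p q r \<theta> (\<lambda>t. x (- t)) (\<lambda>t. y (- t)) (uminus ` K)"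
      proof (rule cuts_at_angle_signI[OF ang \<sigma>'])
        fix t assume "t \<in> uminus ` K"
        then have t: "- t \<in> K" by auto
        have "tangent S (\<lambda>t. x (- t)) (\<lambda>t. y (- t)) t = - tangent S x y (- t)"
          by (rule tangent_reflect) (use adm t in \<open>auto simp: admissible_curve_def\<close>)
        then show "?m (\<lambda>t. x (- t)) (\<lambda>t. y (- t)) t = \<sigma>' * ?n (\<lambda>t. x (- t)) (\<lambda>t. y (- t)) t * ?c"
          using \<sigma>(2)[OF t] by (simp add: 2 lorentz_norm_def)
      qed
      then show ?thesis
        using ang admissible_reflect[OF surf adm] by (simp add: loxodrome_def)
    qed
  qed
  from forward backward show ?thesis by blast
qed

end
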